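(* For $t>0$, $d\ge2$ an integer and $s\in[0,\pi]$ let $$\varrho_{t,d}(s)=\frac{2t^2}{\pi}\,\frac{d\int_0^1u^de^{-\frac{st}\pi u}\,\mathrm du}{2t+d\int_0^1u^{d-2}e^{-tu}\,\mathrm du},\qquad\overline\varrho_t(s)=\frac{2t^2}{\pi}\,\frac{e^{-st/\pi}}{2t+e^{-t}}.$$ Fix $t>0$ and $s\in[0,\pi]$. (i) If $st\le\pi$, then $d\mapsto\varrho_{t,d}(s)$ is strictly increasing for $d\ge2$, and $\varrho_{t,d}(s)<\overline\varrho_t(s)$ for all $d\ge2$. (ii) If $$\frac{st}\pi>1+\frac{(t+1)e^{-t}}{2t+e^{-t}},$$ then $d\mapsto\varrho_{t,d}(s)$ is strictly decreasing for all sufficiently large $d$ and approaches $\overline\varrho_t(s)$ from above (as $d\to\infty$). If $$\frac{st}\pi\le1+\frac{(t+1)e^{-t}}{2t+e^{-t}},$$ then it is strictly increasing for all sufficiently large $d$ and approaches $\overline\varrho_t(s)$ from below.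
   Context: On $(0,\pi)$, $\varrho_{t,d}$ is the density of (the absolutely continuous part of) the length of the typical maximal segment in the isotropic splitting tessellation on the unit sphere $\mathbb S^d$ with time parameter $t$, and $\overline\varrho_t$ is that of the length of the typical edge in the isotropic Poisson hypersphere tessellation with intensity $t$; both are extended to $[0,\pi]$ by the displayed formulas, which are all that is needed for the statement. "Approaches from above (below)" means that the sequence converges to the limit and is strictly larger (smaller) than the limit for all sufficiently large $d$. *)

theory Defs
  imports "HOL-Analysis.Analysis"
begin

text \<open>
  The densities of the typical maximal segment length (splitting tessellation on the d-sphere,
  time t) and of the typical edge length (Poisson hypersphere tessellation, intensity t).
  They are meaningful for t > 0, d \<ge> 2 and 0 \<le> s \<le> pi; in particular the truncated
  subtraction d - 2 on the naturals is the true one for d \<ge> 2, and for d = 2 the factor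
  u ^ (d - 2) is identically 1.
\<close>

definition seg_density :: "real \<Rightarrow> nat \<Rightarrow> real \<Rightarrow> real" where
  "seg_density t d s =
     2 * t\<^sup>2 / pi *
       ((real d * integral {0..1} (\<lambda>u::real. u ^ d * exp (- (s * t / pi) * u))) /
        (2 * t + real d * integral {0..1} (\<lambda>u::real. u ^ (d - 2) * exp (- t * u))))"

definition edge_density :: "real \<Rightarrow> real \<Rightarrow> real" where
  "edge_density t s = 2 * t\<^sup>2 / pi * (exp (- (s * t / pi)) / (2 * t + exp (- t)))"

definition approaches_from_above :: "(nat \<Rightarrow> real) \<Rightarrow> real \<Rightarrow> bool" where
  "approaches_from_above f L \<longleftrightarrow> f \<longlonglongrightarrow> L \<and> (\<forall>\<^sub>F d in sequentially. f d > L)"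

definition approaches_from_below :: "(nat \<Rightarrow> real) \<Rightarrow> real \<Rightarrow> bool" where
  "approaches_from_below f L \<longleftrightarrow> f \<longlonglongrightarrow> L \<and> (\<forall>\<^sub>F d in sequentially. f d < L)"

end

theory Submission
  imports Defs "HOL-Real_Asymp.Real_Asymp"
begin

text \<open>
  With a = st/pi, integration by parts gives a recursion for the integrals of u^n exp(-au) over the
  unit interval. For a \<le> 1 it shows that the numerator of the density is nondecreasing in d
  and the denominator strictly decreasing. In general, iterating it yields an expansion of the
  density to third order in 1/d; the 1/d-coefficient has the sign of
  a - 1 - (t+1)exp(-t)/(2t+exp(-t)), and when it vanishes the coefficient of 1/d^2 is negative.
  The sign of the first nonzero coefficient decides the eventual monotonicity, which together
  with convergence gives the side from which the limit is approached.
\<close>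

section \<open>Exponential moments on the unit interval: recursion and differences in
  \<open>n\<close>\<close>

definition exp_moment :: "real \<Rightarrow> nat \<Rightarrow> real" where
  "exp_moment a n = integral {0..1} (\<lambda>u::real. u ^ n * exp (- a * u))"

lemma exp_moment_integrable: "(\<lambda>u::real. u ^ n * exp (- a * u)) integrable_on {0..1}"
  by (intro integrable_continuous_interval continuous_intros)

lemma exp_moment_nonneg: "0 \<le> exp_moment a n"
  unfolding exp_moment_def by (intro integral_nonneg exp_moment_integrable) auto

text \<open>Integrate the derivative of \<open>u ^ Suc n * exp (- a * u)\<close>; the boundary term
  at 0 vanishes because the exponent is positive.\<close>

lemma exp_moment_rec: "(real n + 1) * exp_moment a n = exp (- a) + a * exp_moment a (Suc n)"
proof -
  have "((\<lambda>u::real. (real n + 1) * (u ^ n * exp (- a * u)) - a * (u ^ Suc n * exp (- a * u)))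
      has_integral 1 ^ Suc n * exp (- a * 1) - 0 ^ Suc n * exp (- a * 0)) {0..1}"
    by (rule fundamental_theorem_of_calculus)
      (auto intro!: derivative_eq_intros
        simp flip: has_real_derivative_iff_has_vector_derivative simp: algebra_simps
        simp del: power_Suc)
  moreover have "((\<lambda>u::real. (real n + 1) * (u ^ n * exp (- a * u)) - a * (u ^ Suc n * exp (- a * u)))
      has_integral (real n + 1) * exp_moment a n - a * exp_moment a (Suc n)) {0..1}"
    unfolding exp_moment_def
    by (intro has_integral_diff has_integral_mult_right integrable_integral exp_moment_integrable)
  ultimately show ?thesis
    by (auto dest: has_integral_unique)
qed

lemma exp_moment_pos:
  assumes "0 \<le> a"
  shows "0 < exp_moment a n"
proof -
  have "0 < (real n + 1) * exp_moment a n"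
    unfolding exp_moment_rec using assms exp_moment_nonneg[of a "Suc n"]
    by (intro add_pos_nonneg mult_nonneg_nonneg) auto
  then show ?thesis by (simp add: zero_less_mult_iff)
qed

lemma exp_moment_first_difference: "exp_moment a (Suc n) \<le> exp_moment a n"
  unfolding exp_moment_def
  by (intro integral_le exp_moment_integrable mult_right_mono power_decreasing) auto

text \<open>The combined integrand is
  \<open>u ^ n * (1 - u)\<^sup>2 * exp (- a * u)\<close>.\<close>

lemma exp_moment_second_difference:
  "0 \<le> exp_moment a n - 2 * exp_moment a (Suc n) + exp_moment a (Suc (Suc n))"
proof -
  have "((\<lambda>u::real. u ^ n * exp (- a * u) - 2 * (u ^ Suc n * exp (- a * u))
        + u ^ Suc (Suc n) * exp (- a * u))
      has_integral exp_moment a n - 2 * exp_moment a (Suc n) + exp_moment a (Suc (Suc n))) {0..1}"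
    unfolding exp_moment_def
    by (intro has_integral_add has_integral_diff has_integral_mult_right integrable_integral
        exp_moment_integrable)
  moreover have "u ^ n * exp (- a * u) - 2 * (u ^ Suc n * exp (- a * u))
        + u ^ Suc (Suc n) * exp (- a * u) = u ^ n * (1 - u)\<^sup>2 * exp (- a * u)" for u :: real
    by (simp add: algebra_simps power2_eq_square)
  ultimately show ?thesis
    by (auto elim!: has_integral_nonneg)
qed

section \<open>Monotonicity of numerator and denominator\<close>

text \<open>By the recursion at \<open>n\<close> and \<open>Suc n\<close>, the increment equals the
  first difference of the moments at \<open>n\<close> minus \<open>a\<close> times the one at
  \<open>Suc n\<close>. Replacing \<open>a\<close> by 1 only lowers it, and leaves the nonnegative
  second difference.\<close>

lemma scaled_exp_moment_mono:
  assumes "0 \<le> a" "a \<le> 1"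
  shows "real n * exp_moment a n \<le> real (Suc n) * exp_moment a (Suc n)"
proof -
  have "a * (exp_moment a (Suc n) - exp_moment a (Suc (Suc n)))
      \<le> 1 * (exp_moment a (Suc n) - exp_moment a (Suc (Suc n)))"
    using assms exp_moment_first_difference by (intro mult_right_mono) auto
  then show ?thesis
    using exp_moment_rec[of n a] exp_moment_rec[of "Suc n" a] exp_moment_second_difference[of a n]
    by (simp add: algebra_simps)
qed

text \<open>The recursion turns \<open>real d * exp_moment t (d - 2)\<close> into d/(d-1) times a
  positive factor that is nonincreasing in d. Strictness comes from d/(d-1).\<close>

lemma scaled_exp_moment_strict_antimono:
  assumes "0 \<le> t" "2 \<le> d"
  shows "real (Suc d) * exp_moment t (Suc d - 2) < real d * exp_moment t (d - 2)"
proof -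
  obtain n where d: "d = Suc (Suc n)"
    using assms(2) by (metis add_2_eq_Suc le_Suc_ex)
  let ?J = "\<lambda>k. exp (- t) + t * exp_moment t k"
  have rec: "exp_moment t k = ?J (Suc k) / (real k + 1)" for k
    using exp_moment_rec[of k t] by (simp add: field_simps)
  have "(real n + 3) / (real n + 2) * ?J (Suc (Suc n)) \<le> (real n + 3) / (real n + 2) * ?J (Suc n)"
    using assms(1) exp_moment_first_difference by (intro mult_left_mono add_left_mono) auto
  also have "\<dots> < (real n + 2) / (real n + 1) * ?J (Suc n)"
    using assms(1) exp_moment_nonneg[of t "Suc n"]
    by (intro mult_strict_right_mono add_pos_nonneg) (auto simp: field_simps)
  finally show ?thesis
    using rec[of n] rec[of "Suc n"] by (simp add: d add_ac)
qed

section \<open>Asymptotics of the moments and their expansions in 1/d\<close>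

lemma exp_moment_tendsto_0:
  assumes "0 \<le> a"
  shows "exp_moment a \<longlonglongrightarrow> 0"
proof (rule tendsto_sandwich[of "\<lambda>_. 0"])
  have "exp_moment a n \<le> (exp (- a) + a * exp_moment a 0) / (real n + 1)" for n
  proof -
    have "decseq (exp_moment a)"
      using exp_moment_first_difference by (intro decseq_SucI)
    then have "exp_moment a (Suc n) \<le> exp_moment a 0"
      by (auto dest: decseqD)
    then have "(real n + 1) * exp_moment a n \<le> exp (- a) + a * exp_moment a 0"
      unfolding exp_moment_rec using assms by (intro add_left_mono mult_left_mono) auto
    then show ?thesis by (simp add: field_simps)
  qed
  then show "\<forall>\<^sub>F n in sequentially. exp_moment a n \<le> (exp (- a) + a * exp_moment a 0) / (real n + 1)"
    by simp
  show "(\<lambda>n. (exp (- a) + a * exp_moment a 0) / (real n + 1)) \<longlonglongrightarrow> 0"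
    by real_asymp
qed (auto simp: exp_moment_nonneg)

lemma scaled_exp_moment_tendsto:
  assumes "0 \<le> a"
  shows "(\<lambda>n. (real n + 1) * exp_moment a n) \<longlonglongrightarrow> exp (- a)"
  unfolding exp_moment_rec
  using exp_moment_tendsto_0[OF assms, THEN LIMSEQ_Suc]
  by (auto intro!: tendsto_eq_intros)

text \<open>The recursion at \<open>n\<close>, \<open>n + 1\<close> and \<open>n + 2\<close>. For
  \<open>a\<close> nonnegative the leftover moment is of order 1/n, so after multiplication by n the
  last term is of order 1/n^3 and does not affect the coefficients up to 1/n^2.\<close>

lemma exp_moment_rec_thrice:
  "exp_moment a n = exp (- a) * (1 / (real n + 1) + a / ((real n + 1) * (real n + 2))
      + a ^ 2 / ((real n + 1) * (real n + 2) * (real n + 3)))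
    + a ^ 3 / ((real n + 1) * (real n + 2) * (real n + 3)) * exp_moment a (n + 3)"
proof -
  have rec: "exp_moment a k = (exp (- a) + a * exp_moment a (Suc k)) / (real k + 1)" for k
    using exp_moment_rec[of k a] by (simp add: field_simps)
  have n3: "n + 3 = Suc (Suc (Suc n))" by simp
  show ?thesis
    unfolding n3 rec[of n] rec[of "Suc n"] rec[of "Suc (Suc n)"]
    by (simp add: divide_simps) (simp add: algebra_simps power2_eq_square power3_eq_cube)
qed

text \<open>
  Since the rescaled remainder converges instead of merely being bounded, consecutive remainders
  differ by o(1/d^3), so that the expansion can be differenced.
\<close>

definition expands :: "(nat \<Rightarrow> real) \<Rightarrow> real \<Rightarrow> real \<Rightarrow> real \<Rightarrow> bool" where
  "expands f c0 c1 c2 \<longleftrightarrow>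
    (\<exists>c3. (\<lambda>d. real d ^ 3 * (f d - (c0 + c1 / real d + c2 / real d ^ 2))) \<longlonglongrightarrow> c3)"

lemma expands_scaled_exp_moment:
  assumes "0 \<le> a"
  shows "expands (\<lambda>d. real d * exp_moment a d)
    (exp (- a)) (exp (- a) * (a - 1)) (exp (- a) * (a\<^sup>2 - 3 * a + 1))"
proof -
  \<comment> \<open>\<open>R\<close> is x^3 times the errors in x/(x+1) = 1 - 1/x + 1/x^2,
    x/((x+1)(x+2)) = 1/x - 3/x^2 and x/((x+1)(x+2)(x+3)) = 1/x^2, weighted by 1, a, a^2. Collecting
    powers of 1/x gives the coefficients claimed.\<close>
  define R where "R = (\<lambda>x. x ^ 3 * (x / (x + 1) - (1 - 1 / x + 1 / x ^ 2))
      + a * (x ^ 3 * (x / ((x + 1) * (x + 2)) - (1 / x - 3 / x ^ 2)))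
      + a\<^sup>2 * (x ^ 3 * (x / ((x + 1) * (x + 2) * (x + 3)) - 1 / x ^ 2)))"
  have R: "(\<lambda>d. R (real d)) \<longlonglongrightarrow> -1 + a * 7 + a\<^sup>2 * (-6)"
    unfolding R_def by (intro tendsto_add tendsto_mult_left; real_asymp)
  \<comment> \<open>The leftover moment needs the factor d + 4 to converge to a nonzero limit;
    \<open>tail\<close> below cancels it again.\<close>
  have "(\<lambda>d. (real (d + 3) + 1) * exp_moment a (d + 3)) \<longlonglongrightarrow> exp (- a)"
    using scaled_exp_moment_tendsto[OF assms] by (rule LIMSEQ_ignore_initial_segment)
  moreover have "(\<lambda>d. real d ^ 4 / ((real d + 1) * (real d + 2) * (real d + 3) * (real d + 4))) \<longlonglongrightarrow> 1"
    by real_asymp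
  ultimately have "(\<lambda>d. exp (- a) * R (real d)
      + a ^ 3 * (real d ^ 4 / ((real d + 1) * (real d + 2) * (real d + 3) * (real d + 4))
        * ((real (d + 3) + 1) * exp_moment a (d + 3))))
      \<longlonglongrightarrow> exp (- a) * (-1 + a * 7 + a\<^sup>2 * (-6)) + a ^ 3 * (1 * exp (- a))"
    using R by (intro tendsto_intros)
  moreover have "exp (- a) * R (real d)
      + a ^ 3 * (real d ^ 4 / ((real d + 1) * (real d + 2) * (real d + 3) * (real d + 4))
        * ((real (d + 3) + 1) * exp_moment a (d + 3)))
      = real d ^ 3 * (real d * exp_moment a d - (exp (- a) + exp (- a) * (a - 1) / real d
        + exp (- a) * (a\<^sup>2 - 3 * a + 1) / real d ^ 2))" for d
  proof -
    have 4: "real (d + 3) + 1 = real d + 4" "real d + 4 \<noteq> 0" by simp_all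
    have tail: "real d ^ 4 / ((real d + 1) * (real d + 2) * (real d + 3) * (real d + 4))
        * ((real (d + 3) + 1) * exp_moment a (d + 3))
        = real d ^ 4 / ((real d + 1) * (real d + 2) * (real d + 3)) * exp_moment a (d + 3)"
      unfolding 4 using 4(2) by simp
    \<comment> \<open>Both sides are linear in the reciprocals, which \<open>algebra\<close> can
      treat as atoms; no denominator has to be assumed nonzero.\<close>
    have "e * R x + a ^ 3 * (x ^ 4 / ((x + 1) * (x + 2) * (x + 3)) * r)
      = x ^ 3 * (x * (e * (1 / (x + 1) + a / ((x + 1) * (x + 2))
          + a\<^sup>2 / ((x + 1) * (x + 2) * (x + 3))) + a ^ 3 / ((x + 1) * (x + 2) * (x + 3)) * r)
        - (e + e * (a - 1) / x + e * (a\<^sup>2 - 3 * a + 1) / x ^ 2))" for x e r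
      unfolding R_def divide_inverse by algebra
    then show ?thesis
      unfolding tail exp_moment_rec_thrice[of a d] .
  qed
  ultimately show ?thesis
    unfolding expands_def by (simp only:) (rule exI)
qed

lemma expands_denominator:
  assumes "0 \<le> t"
  shows "expands (\<lambda>d. 2 * t + real d * exp_moment t (d - 2))
    (2 * t + exp (- t)) (exp (- t) * (1 + t)) (exp (- t) * (1 + t + t\<^sup>2))"
proof -
  \<comment> \<open>As for the numerator, but with \<open>n = d - 2\<close>, so the factors n+1,
    n+2, n+3 become d-1, d, d+1.\<close>
  define R where "R = (\<lambda>x. x ^ 3 * (x / (x - 1) - (1 + 1 / x + 1 / x ^ 2))
      + t * (x ^ 3 * (x / ((x - 1) * x) - (1 / x + 1 / x ^ 2)))
      + t\<^sup>2 * (x ^ 3 * (x / ((x - 1) * x * (x + 1)) - 1 / x ^ 2)))"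
  have R: "(\<lambda>d. R (real d)) \<longlonglongrightarrow> 1 + t * 1 + t\<^sup>2 * 0"
    unfolding R_def by (intro tendsto_add tendsto_mult_left; real_asymp)
  have "(\<lambda>d. (real (d + 1) + 1) * exp_moment t (d + 1)) \<longlonglongrightarrow> exp (- t)"
    using scaled_exp_moment_tendsto[OF assms] by (rule LIMSEQ_ignore_initial_segment)
  moreover have "(\<lambda>d. real d ^ 4 / ((real d - 1) * real d * (real d + 1) * (real d + 2))) \<longlonglongrightarrow> 1"
    by real_asymp
  ultimately have "(\<lambda>d. exp (- t) * R (real d)
      + t ^ 3 * (real d ^ 4 / ((real d - 1) * real d * (real d + 1) * (real d + 2))
        * ((real (d + 1) + 1) * exp_moment t (d + 1))))
      \<longlonglongrightarrow> exp (- t) * (1 + t * 1 + t\<^sup>2 * 0) + t ^ 3 * (1 * exp (- t))"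
    using R by (intro tendsto_intros)
  moreover have "\<forall>\<^sub>F d in sequentially. exp (- t) * R (real d)
      + t ^ 3 * (real d ^ 4 / ((real d - 1) * real d * (real d + 1) * (real d + 2))
        * ((real (d + 1) + 1) * exp_moment t (d + 1)))
      = real d ^ 3 * (2 * t + real d * exp_moment t (d - 2) - (2 * t + exp (- t)
        + exp (- t) * (1 + t) / real d + exp (- t) * (1 + t + t\<^sup>2) / real d ^ 2))"
    using eventually_ge_at_top[of 2]
  proof eventually_elim
    case (elim d)
    have 2: "real (d + 1) + 1 = real d + 2" "real d + 2 \<noteq> 0" by simp_all
    have tail: "real d ^ 4 / ((real d - 1) * real d * (real d + 1) * (real d + 2))
        * ((real (d + 1) + 1) * exp_moment t (d + 1))
        = real d ^ 4 / ((real d - 1) * real d * (real d + 1)) * exp_moment t (d + 1)"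
      unfolding 2 using 2(2) by simp
    \<comment> \<open>Here \<open>2 \<le> d\<close> matters: the natural subtraction must not
      truncate.\<close>
    have shift: "real (d - 2) + 1 = real d - 1" "real (d - 2) + 2 = real d"
        "real (d - 2) + 3 = real d + 1" "d - 2 + 3 = d + 1"
      using elim by (simp_all add: of_nat_diff)
    have "e * R x + t ^ 3 * (x ^ 4 / ((x - 1) * x * (x + 1)) * r)
      = x ^ 3 * (2 * t + x * (e * (1 / (x - 1) + t / ((x - 1) * x)
          + t\<^sup>2 / ((x - 1) * x * (x + 1))) + t ^ 3 / ((x - 1) * x * (x + 1)) * r)
        - (2 * t + e + e * (1 + t) / x + e * (1 + t + t\<^sup>2) / x ^ 2))" for x e r
      unfolding R_def divide_inverse by algebra
    then show ?case
      unfolding tail exp_moment_rec_thrice[of t "d - 2"] shift .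
  qed
  ultimately show ?thesis
    unfolding expands_def by - (rule exI, erule (1) Lim_transform_eventually)
qed

section \<open>Quotients and differences of expansions\<close>

lemma expands_tendsto:
  assumes "expands f c0 c1 c2"
  shows "f \<longlonglongrightarrow> c0"
proof -
  obtain c3 where lim: "(\<lambda>d. real d ^ 3 * (f d - (c0 + c1 / real d + c2 / real d ^ 2))) \<longlonglongrightarrow> c3"
    using assms by (auto simp: expands_def)
  have "(\<lambda>d. 1 / real d ^ 3) \<longlonglongrightarrow> 0" "(\<lambda>d. c0 + c1 / real d + c2 / real d ^ 2) \<longlonglongrightarrow> c0"
    by real_asymp+
  with lim have "(\<lambda>d. 1 / real d ^ 3 * (real d ^ 3 * (f d - (c0 + c1 / real d + c2 / real d ^ 2)))
      + (c0 + c1 / real d + c2 / real d ^ 2)) \<longlonglongrightarrow> 0 * c3 + c0"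
    by (intro tendsto_intros)
  moreover have "\<forall>\<^sub>F d in sequentially.
      1 / real d ^ 3 * (real d ^ 3 * (f d - (c0 + c1 / real d + c2 / real d ^ 2)))
      + (c0 + c1 / real d + c2 / real d ^ 2) = f d"
    using eventually_gt_at_top[of 0] by eventually_elim simp
  ultimately have "f \<longlonglongrightarrow> 0 * c3 + c0"
    by (rule Lim_transform_eventually)
  then show ?thesis by simp
qed

text \<open>The coefficients of \<open>f\<close> are prescribed as the Cauchy product of the
  \<open>c\<close>'s and \<open>b\<close>'s, so quotient coefficients are verified rather than
  computed. The error of the quotient is that of \<open>f - C * g\<close> divided by
  \<open>g\<close>, where C is the candidate expansion.\<close>

lemma expands_divide:
  assumes f: "expands f (c0 * b0) (c0 * b1 + c1 * b0) (c0 * b2 + c1 * b1 + c2 * b0)"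
    and g: "expands g b0 b1 b2" and "b0 \<noteq> 0"
  shows "expands (\<lambda>d. f d / g d) c0 c1 c2"
proof -
  let ?P = "\<lambda>x0 x1 x2 d. x0 + x1 / real d + x2 / real d ^ 2"
  let ?A = "?P (c0 * b0) (c0 * b1 + c1 * b0) (c0 * b2 + c1 * b1 + c2 * b0)"
  let ?B = "?P b0 b1 b2" and ?C = "?P c0 c1 c2"
  obtain k l where k: "(\<lambda>d. real d ^ 3 * (f d - ?A d)) \<longlonglongrightarrow> k"
    and l: "(\<lambda>d. real d ^ 3 * (g d - ?B d)) \<longlonglongrightarrow> l"
    using f g by (auto simp: expands_def)
  have g0: "g \<longlonglongrightarrow> b0" using g by (rule expands_tendsto)
  have C: "?C \<longlonglongrightarrow> c0" by real_asymp
  \<comment> \<open>The terms of order 1/d^3 and 1/d^4 in the product of the two truncated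
    expansions, multiplied by d^3.\<close>
  have P: "(\<lambda>d. c1 * b2 + c2 * b1 + c2 * b2 / real d) \<longlonglongrightarrow> c1 * b2 + c2 * b1" by real_asymp
  have "(\<lambda>d. (real d ^ 3 * (f d - ?A d) - ?C d * (real d ^ 3 * (g d - ?B d))
      - (c1 * b2 + c2 * b1 + c2 * b2 / real d)) / g d)
    \<longlonglongrightarrow> (k - c0 * l - (c1 * b2 + c2 * b1)) / b0"
    using k l g0 C P \<open>b0 \<noteq> 0\<close> by (intro tendsto_divide tendsto_diff tendsto_mult)
  moreover have "\<forall>\<^sub>F d in sequentially. g d \<noteq> 0"
    using g0 \<open>b0 \<noteq> 0\<close> by (rule tendsto_imp_eventually_ne)
  then have "\<forall>\<^sub>F d in sequentially. (real d ^ 3 * (f d - ?A d) - ?C d * (real d ^ 3 * (g d - ?B d))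
      - (c1 * b2 + c2 * b1 + c2 * b2 / real d)) / g d = real d ^ 3 * (f d / g d - ?C d)"
    using eventually_gt_at_top[of 0]
  proof eventually_elim
    case (elim d)
    have "x ^ 3 * (c0 * b0 + (c0 * b1 + c1 * b0) * w + (c0 * b2 + c1 * b1 + c2 * b0) * w ^ 2)
        + (c1 * b2 + c2 * b1 + c2 * b2 * w)
        = x ^ 3 * ((b0 + b1 * w + b2 * w ^ 2) * (c0 + c1 * w + c2 * w ^ 2))"
      if "x * w = 1" for x w :: real
      using that by algebra
    from this[of "real d" "inverse (real d)"] elim
    have remainder: "real d ^ 3 * ?A d + (c1 * b2 + c2 * b1 + c2 * b2 / real d) = real d ^ 3 * (?B d * ?C d)"
      by (simp add: divide_inverse power_inverse)
    have "x * (y - A) - C * (x * (z - B)) - r = x * (y - C * z)"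
      if "x * A + r = x * (B * C)" for x y z A B C r :: real
      using that by algebra
    from this[OF remainder] have "real d ^ 3 * (f d - ?A d) - ?C d * (real d ^ 3 * (g d - ?B d))
      - (c1 * b2 + c2 * b1 + c2 * b2 / real d) = real d ^ 3 * (f d - ?C d * g d)"
      .
    moreover have "f d / g d - ?C d = (f d - ?C d * g d) / g d"
      using elim by (simp add: diff_divide_distrib)
    ultimately show ?case by simp
  qed
  ultimately show ?thesis
    unfolding expands_def by - (rule exI, erule (1) Lim_transform_eventually)
qed

text \<open>Times d^3, the \<open>c2\<close> term contributes \<open>- 2 * c2\<close> in the limit
  and the two remainders cancel, both tending to the same \<open>c3\<close>. The \<open>c1\<close>
  term gives exactly -c1 d^2/(d+1), which is unbounded unless \<open>c1 = 0\<close> and is therefore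
  moved to the left.\<close>

lemma expands_difference:
  assumes "expands f c0 c1 c2"
  shows "(\<lambda>d. real d ^ 3 * (f (Suc d) - f d) + c1 * (real d ^ 2 / (real d + 1))) \<longlonglongrightarrow> - 2 * c2"
proof -
  let ?e = "\<lambda>d. f d - (c0 + c1 / real d + c2 / real d ^ 2)"
  obtain c3 where lim: "(\<lambda>d. real d ^ 3 * ?e d) \<longlonglongrightarrow> c3"
    using assms by (auto simp: expands_def)
  have r: "(\<lambda>d. real d ^ 3 / (real d + 1) ^ 3) \<longlonglongrightarrow> 1"
    and q: "(\<lambda>d. c2 * (real d ^ 3 * (1 / (real d + 1) ^ 2 - 1 / real d ^ 2))) \<longlonglongrightarrow> - 2 * c2"
    by real_asymp+
  have "(\<lambda>d. real d ^ 3 / (real d + 1) ^ 3 * (real (Suc d) ^ 3 * ?e (Suc d)) - real d ^ 3 * ?e d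
      + c2 * (real d ^ 3 * (1 / (real d + 1) ^ 2 - 1 / real d ^ 2))) \<longlonglongrightarrow> 1 * c3 - c3 + - 2 * c2"
    by (intro tendsto_intros r q lim LIMSEQ_Suc[OF lim])
  moreover have "\<forall>\<^sub>F d in sequentially.
      real d ^ 3 / (real d + 1) ^ 3 * (real (Suc d) ^ 3 * ?e (Suc d)) - real d ^ 3 * ?e d
      + c2 * (real d ^ 3 * (1 / (real d + 1) ^ 2 - 1 / real d ^ 2))
      = real d ^ 3 * (f (Suc d) - f d) + c1 * (real d ^ 2 / (real d + 1))"
    using eventually_gt_at_top[of 0]
  proof eventually_elim
    case (elim d)
    have rescale: "real d ^ 3 / (real d + 1) ^ 3 * (real (Suc d) ^ 3 * ?e (Suc d)) = real d ^ 3 * ?e (Suc d)"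
      by (simp add: add_ac)
    have "x ^ 3 * (c1 * u - c1 * v) = c1 * (x ^ 2 * v)" if "x * u = 1" "(x + 1) * v = 1" for x u v :: real
      using that by algebra
    from this[of "real d" "inverse (real d)" "inverse (real d + 1)"] elim
    have first_order: "real d ^ 3 * (c1 / real d - c1 / (real d + 1)) = c1 * (real d ^ 2 / (real d + 1))"
      by (simp add: divide_inverse)
    have combine: "z * (p - (c0 + c1 / y + c2 / y ^ 2)) - z * (q - (c0 + c1 / x + c2 / x ^ 2))
        + c2 * (z * (1 / y ^ 2 - 1 / x ^ 2)) = z * (p - q) + z * (c1 / x - c1 / y)"
      for x y z p q :: real
      unfolding divide_inverse by algebra
    have Suc: "real (Suc d) = real d + 1" by simp
    show ?case
      unfolding rescale first_order[symmetric] unfolding Suc by (rule combine)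
  qed
  ultimately have "(\<lambda>d. real d ^ 3 * (f (Suc d) - f d) + c1 * (real d ^ 2 / (real d + 1)))
      \<longlonglongrightarrow> 1 * c3 - c3 + - 2 * c2"
    by (rule Lim_transform_eventually)
  then show ?thesis by simp
qed

lemma expands_eventually_less_Suc:
  assumes f: "expands f c0 c1 c2" and c: "c1 < 0 \<or> c1 = 0 \<and> c2 < 0"
  shows "\<forall>\<^sub>F d in sequentially. f d < f (Suc d)"
proof -
  let ?D = "\<lambda>d. real d ^ 3 * (f (Suc d) - f d) + c1 * (real d ^ 2 / (real d + 1))"
  \<comment> \<open>This says that d^3 times the increment is positive. If \<open>c1 = 0\<close> the
    limit \<open>- 2 * c2\<close> is positive; if \<open>c1 < 0\<close> the right side tends to
    minus infinity while \<open>?D\<close> converges.\<close>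
  have "\<forall>\<^sub>F d in sequentially. ?D d > c1 * (real d ^ 2 / (real d + 1))"
  proof (cases "c1 = 0")
    case True
    with c have "- 2 * c2 > 0" by simp
    with True show ?thesis
      using order_tendstoD(1)[OF expands_difference[OF f]] by fastforce
  next
    case False
    with c have "c1 < 0" by simp
    then have "filterlim (\<lambda>d. c1 * (real d ^ 2 / (real d + 1))) at_bot sequentially"
      by real_asymp
    then have "\<forall>\<^sub>F d in sequentially. c1 * (real d ^ 2 / (real d + 1)) \<le> - 2 * c2 - 1"
      by (auto simp: filterlim_at_bot)
    moreover have "\<forall>\<^sub>F d in sequentially. ?D d > - 2 * c2 - 1"
      by (rule order_tendstoD(1)[OF expands_difference[OF f]]) simp
    ultimately show ?thesis
      by eventually_elim simp
  qed
  then show ?thesis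
    by eventually_elim (auto simp: zero_less_mult_iff)
qed

text \<open>Reduces the eventually decreasing case to the increasing one.\<close>

lemma expands_uminus:
  assumes "expands f c0 c1 c2"
  shows "expands (\<lambda>d. - f d) (- c0) (- c1) (- c2)"
proof -
  obtain c3 where "(\<lambda>d. real d ^ 3 * (f d - (c0 + c1 / real d + c2 / real d ^ 2))) \<longlonglongrightarrow> c3"
    using assms by (auto simp: expands_def)
  from tendsto_minus[OF this] show ?thesis
    unfolding expands_def by (auto simp: algebra_simps intro!: exI[of _ "- c3"])
qed

section \<open>Monotone sequences and the side from which they approach their limit\<close>

lemma strict_mono_on_atLeast_SucI:
  fixes f :: "nat \<Rightarrow> real"
  assumes "\<And>d. D \<le> d \<Longrightarrow> f d < f (Suc d)"
  shows "strict_mono_on {D..} f"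
proof (rule strict_mono_onI)
  fix m n assume "m \<in> {D..}" "m < n"
  from \<open>m < n\<close> show "f m < f n"
  proof (induction n)
    case (Suc n)
    with assms[of n] \<open>m \<in> {D..}\<close> show ?case
      by (cases "m = n") auto
  qed simp
qed

lemma strict_mono_on_atLeast_less_limit:
  fixes f :: "nat \<Rightarrow> real"
  assumes mono: "strict_mono_on {D..} f" and lim: "f \<longlonglongrightarrow> L" and d: "D \<le> d"
  shows "f d < L"
proof -
  have less: "f m < f n" if "D \<le> m" "m < n" for m n
    using strict_mono_onD[OF mono] that by simp
  \<comment> \<open>Passing to the limit loses strictness, so the bound is taken at
    \<open>Suc d\<close> and the strict step from \<open>d\<close> restores it.\<close>
  have "\<forall>\<^sub>F n in sequentially. f (Suc d) \<le> f n"
    using eventually_ge_at_top[of "Suc d"]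
  proof eventually_elim
    case (elim n)
    then show ?case using less[of "Suc d" n] d by (cases "n = Suc d") auto
  qed
  then have "f (Suc d) \<le> L"
    by (intro tendsto_lowerbound[OF lim]) auto
  with less[of d "Suc d"] d show ?thesis by simp
qed

lemma eventually_strict_mono_on_approaches:
  assumes less: "\<forall>\<^sub>F d in sequentially. f d < f (Suc d)" and lim: "f \<longlonglongrightarrow> L"
  shows "\<exists>D\<ge>2. strict_mono_on {D..} f" and "approaches_from_below f L"
proof -
  obtain N where "\<And>d. N \<le> d \<Longrightarrow> f d < f (Suc d)"
    using less by (auto simp: eventually_sequentially)
  then have mono: "strict_mono_on {max 2 N..} f"
    by (intro strict_mono_on_atLeast_SucI) auto
  then show "\<exists>D\<ge>2. strict_mono_on {D..} f"
    by (intro exI[of _ "max 2 N"]) simp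
  show "approaches_from_below f L"
    unfolding approaches_from_below_def eventually_sequentially
    using strict_mono_on_atLeast_less_limit[OF mono lim] lim by blast
qed

section \<open>Application to the densities\<close>

lemma seg_density_eq:
  "seg_density t d s = 2 * t\<^sup>2 / pi *
    (real d * exp_moment (s * t / pi) d / (2 * t + real d * exp_moment t (d - 2)))"
  by (simp add: seg_density_def exp_moment_def)

theorem proposition6p2:
  fixes t s :: real
  assumes "t > 0" and "s \<in> {0..pi}"
  shows
    "(s * t \<le> pi \<longrightarrow>
        strict_mono_on {2..} (\<lambda>d. seg_density t d s) \<and>
        (\<forall>d\<ge>2. seg_density t d s < edge_density t s)) \<and>
     (s * t / pi > 1 + (t + 1) * exp (- t) / (2 * t + exp (- t)) \<longrightarrow>
        (\<exists>D\<ge>2. strict_antimono_on {D..} (\<lambda>d. seg_density t d s)) \<and>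
        approaches_from_above (\<lambda>d. seg_density t d s) (edge_density t s)) \<and>
     (s * t / pi \<le> 1 + (t + 1) * exp (- t) / (2 * t + exp (- t)) \<longrightarrow>
        (\<exists>D\<ge>2. strict_mono_on {D..} (\<lambda>d. seg_density t d s)) \<and>
        approaches_from_below (\<lambda>d. seg_density t d s) (edge_density t s))"
proof -
  define a where "a = s * t / pi"
  define m where "m = 2 * t + exp (- t)"
  define \<kappa> where "\<kappa> = (t + 1) * exp (- t) / m"
  \<comment> \<open>\<open>c1\<close> and \<open>c2\<close> solve the Cauchy product equations of
    \<open>expands_divide\<close> for the quotient \<open>q\<close>; \<open>\<kappa>\<close> is the
    denominator's 1/d coefficient relative to its limit \<open>m\<close>.\<close>
  define c1 where "c1 = exp (- a) / m * (a - 1 - \<kappa>)"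
  define c2 where "c2 = exp (- a) / m * (a\<^sup>2 - 3 * a + 1 - exp (- t) * (1 + t + t\<^sup>2) / m - \<kappa> * (a - 1 - \<kappa>))"
  define q where "q = (\<lambda>d. real d * exp_moment a d / (2 * t + real d * exp_moment t (d - 2)))"
  have a: "0 \<le> a" using assms by (simp add: a_def)
  have m: "0 < m" using assms by (simp add: m_def add_pos_pos)
  have \<kappa>: "0 \<le> \<kappa>" "\<kappa> \<le> 1"
  proof -
    \<comment> \<open>After clearing \<open>m\<close>, the bound \<open>\<kappa> \<le> 1\<close>
      amounts to \<open>t * exp (- t) \<le> 2 * t\<close>.\<close>
    have "t * exp (- t) \<le> t * 2" using assms by (intro mult_left_mono) (auto intro: order.trans[of _ 1])
    then show "0 \<le> \<kappa>" "\<kappa> \<le> 1" using assms m by (auto simp: \<kappa>_def m_def field_simps)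
  qed
  have seg: "seg_density t d s = 2 * t\<^sup>2 / pi * q d" for d
    by (simp add: seg_density_eq q_def a_def)
  have edge: "edge_density t s = 2 * t\<^sup>2 / pi * (exp (- a) / m)"
    by (simp add: edge_density_def a_def m_def)
  have C: "0 < 2 * t\<^sup>2 / pi" using assms by simp
  have q: "expands q (exp (- a) / m) c1 c2"
    unfolding q_def
  proof (rule expands_divide)
    show "expands (\<lambda>d. 2 * t + real d * exp_moment t (d - 2)) m (exp (- t) * (1 + t)) (exp (- t) * (1 + t + t\<^sup>2))"
      unfolding m_def using assms by (intro expands_denominator) simp
    have \<kappa>m: "exp (- t) * (1 + t) = \<kappa> * m" using m by (simp add: \<kappa>_def ac_simps)
    have "exp (- a) / m * m = exp (- a)"
      "exp (- a) / m * (\<kappa> * m) + c1 * m = exp (- a) * (a - 1)"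
      "exp (- a) / m * (exp (- t) * (1 + t + t\<^sup>2)) + c1 * (\<kappa> * m) + c2 * m = exp (- a) * (a\<^sup>2 - 3 * a + 1)"
      using m by (simp_all add: c1_def c2_def divide_simps) (simp_all add: algebra_simps)
    then show "expands (\<lambda>d. real d * exp_moment a d) (exp (- a) / m * m)
        (exp (- a) / m * (exp (- t) * (1 + t)) + c1 * m)
        (exp (- a) / m * (exp (- t) * (1 + t + t\<^sup>2)) + c1 * (exp (- t) * (1 + t)) + c2 * m)"
      unfolding \<kappa>m using expands_scaled_exp_moment[OF a] by simp
  qed (use m in simp)
  \<comment> \<open>At the threshold \<open>c1\<close> vanishes and \<open>c2\<close> decides. There
    the polynomial in \<open>a\<close> becomes \<open>\<kappa> * \<kappa> - \<kappa> - 1\<close>, at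
    most -1 because \<open>\<kappa>\<close> lies in [0,1].\<close>
  have c2: "c2 < 0" if "a = 1 + \<kappa>"
  proof -
    have "\<kappa> * \<kappa> \<le> 1 * \<kappa>" using \<kappa> by (intro mult_right_mono)
    moreover have "0 \<le> exp (- t) * (1 + t + t\<^sup>2) / m" using assms m by simp
    moreover have "a\<^sup>2 - 3 * a + 1 = \<kappa> * \<kappa> - \<kappa> - 1"
      unfolding that by (simp add: power2_eq_square algebra_simps)
    ultimately have "a\<^sup>2 - 3 * a + 1 - exp (- t) * (1 + t + t\<^sup>2) / m - \<kappa> * (a - 1 - \<kappa>) < 0"
      using \<kappa> that by simp
    then show ?thesis unfolding c2_def using m by (intro mult_pos_neg) auto
  qed
  have lim: "(\<lambda>d. seg_density t d s) \<longlonglongrightarrow> edge_density t s"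
    unfolding seg edge by (intro tendsto_intros expands_tendsto[OF q])
  have i: "strict_mono_on {2..} (\<lambda>d. seg_density t d s) \<and>
      (\<forall>d\<ge>2. seg_density t d s < edge_density t s)" if "s * t \<le> pi"
  proof -
    have "a \<le> 1" using that by (simp add: a_def)
    have "q d < q (Suc d)" if "2 \<le> d" for d
      unfolding q_def
    \<comment> \<open>The numerator only needs to be nondecreasing; strictness comes from the
      denominator.\<close>
    proof (rule frac_less2)
      show "0 < real d * exp_moment a d" using exp_moment_pos[OF a] that by simp
      show "0 < 2 * t + real (Suc d) * exp_moment t (Suc d - 2)"
        using assms exp_moment_nonneg by (intro add_pos_nonneg mult_nonneg_nonneg) auto
    qed (use scaled_exp_moment_mono[OF a \<open>a \<le> 1\<close>]
        scaled_exp_moment_strict_antimono[of t d] assms that in auto)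
    then have "strict_mono_on {2..} (\<lambda>d. seg_density t d s)"
      unfolding seg using C by (intro strict_mono_on_atLeast_SucI mult_strict_left_mono)
    with lim show ?thesis by (auto intro: strict_mono_on_atLeast_less_limit)
  qed
  have ii_above: "(\<exists>D\<ge>2. strict_antimono_on {D..} (\<lambda>d. seg_density t d s)) \<and>
      approaches_from_above (\<lambda>d. seg_density t d s) (edge_density t s)" if "a > 1 + \<kappa>"
  proof -
    have "c1 > 0" unfolding c1_def using that m by simp
    then have "\<forall>\<^sub>F d in sequentially. - q d < - q (Suc d)"
      by (intro expands_eventually_less_Suc[OF expands_uminus[OF q]]) simp
    then have "\<forall>\<^sub>F d in sequentially. - seg_density t d s < - seg_density t (Suc d) s"
      unfolding seg by eventually_elim (simp only: neg_less_iff_less mult_less_cancel_left_pos[OF C])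
    from eventually_strict_mono_on_approaches[OF this tendsto_minus[OF lim]] lim show ?thesis
      unfolding approaches_from_below_def approaches_from_above_def monotone_on_def by simp
  qed
  have ii_below: "(\<exists>D\<ge>2. strict_mono_on {D..} (\<lambda>d. seg_density t d s)) \<and>
      approaches_from_below (\<lambda>d. seg_density t d s) (edge_density t s)" if "a \<le> 1 + \<kappa>"
  proof -
    have "c1 < 0 \<or> c1 = 0 \<and> c2 < 0"
    proof (cases "a = 1 + \<kappa>")
      case True
      then show ?thesis using c2 by (simp add: c1_def)
    next
      case False
      then show ?thesis using that m unfolding c1_def by (intro disjI1 mult_pos_neg) auto
    qed
    then have "\<forall>\<^sub>F d in sequentially. q d < q (Suc d)"
      by (rule expands_eventually_less_Suc[OF q])
    then have "\<forall>\<^sub>F d in sequentially. seg_density t d s < seg_density t (Suc d) s"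
      unfolding seg by eventually_elim (simp only: neg_less_iff_less mult_less_cancel_left_pos[OF C])
    from eventually_strict_mono_on_approaches[OF this lim] show ?thesis by simp
  qed
  show ?thesis
    using i ii_above ii_below unfolding a_def \<kappa>_def m_def by blast
qed

end
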